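(* Let $a,b,c,d,e,x,y,z,w,u,p,q$ be nonzero complex numbers, let $r_i,s_i$ ($1\le i\le4$) be nonnegative real numbers, $r=r_1+r_2+r_3+r_4$, $s=s_1+s_2+s_3+s_4$, and let $n\ge0$ be an integer. Assume that no denominator below vanishes. Then $$\frac{a}{c}\sum_{k=0}^{n-1}\mathcal D\Bigl(\tfrac{ce}{a}p^{(r_3+r_4-r_1-r_2)(k-1)},\tfrac{bc}{a}p^{(r_1+r_4-r_2-r_3)(k-1)},\tfrac{cd}{a}p^{(r_2+r_4-r_1-r_3)(k-1)},\tfrac{bcde}{a}p^{r(k-1)+2}\Bigr)p^{(r-2r_4)(k-1)+1}$$ $$\times\frac{(bp;p^{2r_1})_{k-1}(dp;p^{2r_2})_{k-1}(ep;p^{2r_3})_{k-1}(bc^2dep/a^2;p^{2r_4})_{k-1}}{(cdep/a;p^{r-2r_1})_k(bcep/a;p^{r-2r_2})_k(bcdp/a;p^{r-2r_3})_k(ap/c;p^{r-2r_4})_k}$$ $$\times\frac{(yq;q^{2s_1})_k(wq;q^{2s_2})_k(uq;q^{2s_3})_k(yz^2wuq/x^2;q^{2s_4})_k}{(zwuq/x;q^{s-2s_1})_k(yzuq/x;q^{s-2s_2})_k(yzwq/x;q^{s-2s_3})_k(xq/z;q^{s-2s_4})_k}$$ $$=\frac{(bp;p^{2r_1})_{n-1}(dp;p^{2r_2})_{n-1}(ep;p^{2r_3})_{n-1}(bc^2dep/a^2;p^{2r_4})_{n-1}}{(cdep/a;p^{r-2r_1})_{n-1}(bcep/a;p^{r-2r_2})_{n-1}(bcdp/a;p^{r-2r_3})_{n-1}(ap/c;p^{r-2r_4})_{n-1}}$$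 $$\times\frac{(yq;q^{2s_1})_n(wq;q^{2s_2})_n(uq;q^{2s_3})_n(yz^2wuq/x^2;q^{2s_4})_n}{(zwuq/x;q^{s-2s_1})_n(yzuq/x;q^{s-2s_2})_n(yzwq/x;q^{s-2s_3})_n(xq/z;q^{s-2s_4})_n}$$ $$-\frac{(p^{r-2r_1}-cdep/a)(p^{r-2r_2}-bcep/a)(p^{r-2r_3}-bcdp/a)(p^{r-2r_4}-ap/c)}{(p^{2r_1}-bp)(p^{2r_2}-dp)(p^{2r_3}-ep)(p^{2r_4}-bc^2dep/a^2)}$$ $$-\frac{x}{z}\sum_{k=0}^{n-1}\mathcal D\Bigl(\tfrac{yz}{x}q^{(s_1+s_4-s_2-s_3)k},\tfrac{zu}{x}q^{(s_3+s_4-s_1-s_2)k},\tfrac{zw}{x}q^{(s_2+s_4-s_1-s_3)k},\tfrac{yzwu}{x}q^{sk+2}\Bigr)q^{(s-2s_4)k+1}$$ $$\times\frac{(yq;q^{2s_1})_k(wq;q^{2s_2})_k(uq;q^{2s_3})_k(yz^2wuq/x^2;q^{2s_4})_k}{(zwuq/x;q^{s-2s_1})_{k+1}(yzuq/x;q^{s-2s_2})_{k+1}(yzwq/x;q^{s-2s_3})_{k+1}(xq/z;q^{s-2s_4})_{k+1}}$$ $$\times\frac{(bp;p^{2r_1})_k(dp;p^{2r_2})_k(ep;p^{2r_3})_k(bc^2dep/a^2;p^{2r_4})_k}{(cdep/a;p^{r-2r_1})_k(bcep/a;p^{r-2r_2})_k(bcdp/a;p^{r-2r_3})_k(ap/c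;p^{r-2r_4})_k}.$$
   Context: $\mathcal D(x_1,\dots,x_m):=\prod_{i=1}^m(1-x_i)$. For a nonzero base $q$ and an integer $m\ge 0$, $(a;q)_m=\prod_{j=0}^{m-1}(1-aq^j)$, and $(a;q)_{-1}=1/(1-a/q)$. Real powers are $p^t=\exp(t\log p)$, $q^t=\exp(t\log q)$ for fixed choices of $\log p$, $\log q$. Empty sums are $0$. *)

theory Defs
  imports Complex_Main
begin

definition Dprod :: "complex list \<Rightarrow> complex" where
  "Dprod xs = (\<Prod>t\<leftarrow>xs. 1 - t)"

text \<open>
  A fixed choice of logarithm of a nonzero complex number is a parameter \<open>l\<close>, so that
  \<open>rpow l t\<close> is the real power \<open>p\<close> to the \<open>t\<close> determined by that choice whenever \<open>exp l = p\<close>.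
\<close>

definition rpow :: "complex \<Rightarrow> real \<Rightarrow> complex" where
  "rpow l t = exp (complex_of_real t * l)"

text \<open>
  The \<open>q\<close>-shifted factorial, with the usual extension to negative index, which at index
  \<open>-1\<close> reads \<open>1 / (1 - a / q)\<close>. Since \<open>1 / 0 = 0\<close>, the inequality \<open>qpoch a q (- 1) \<noteq> 0\<close>
  says exactly that the denominator \<open>1 - a / q\<close> does not vanish.
\<close>

definition qpoch :: "complex \<Rightarrow> complex \<Rightarrow> int \<Rightarrow> complex" where
  "qpoch a q m =
     (if 0 \<le> m then \<Prod>j<nat m. 1 - a * q ^ j
      else 1 / (\<Prod>j=1..nat (- m). 1 - a / q ^ j))"

end

(* Write U k and V k for the quotients of shifted factorials in the bases p and q. Both sums are
   of the form "difference times the other sequence": the first is the sum of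
   (U k - U (k - 1)) * V k and the second the sum of U k * (V (k + 1) - V k), so that the theorem
   is summation by parts. The subtracted quotient is U (- 1), and the differences factor by an
   identity for quadruples whose product is a square. *)

theory Submission
  imports Defs
begin

section \<open>Real powers, and shifted factorials at the indices k + 1 and -1\<close>

lemma rpow_add: "rpow l (s + t) = rpow l s * rpow l t"
  by (simp add: rpow_def distrib_right exp_add)

lemma rpow_diff: "rpow l (s - t) = rpow l s / rpow l t"
  by (simp add: rpow_def left_diff_distrib exp_diff)

lemma rpow_of_nat: "rpow l (of_nat n) = exp l ^ n"
  by (simp add: rpow_def exp_of_nat_mult)

lemma rpow_0 [simp]: "rpow l 0 = 1"
  and rpow_1 [simp]: "rpow l 1 = exp l"
  by (simp_all add: rpow_def)

lemma rpow_2 [simp]: "rpow l 2 = exp l ^ 2"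
  using rpow_of_nat[of l 2] by simp

lemma rpow_nonzero [simp]: "rpow l t \<noteq> 0"
  by (simp add: rpow_def)

lemma rpow_power: "rpow l t ^ n = rpow l (t * real n)"
  by (simp add: rpow_def mult_ac flip: exp_of_nat_mult)

lemma rpow_mult_2: "rpow l (2 * t) = rpow l t ^ 2"
  by (simp add: rpow_power mult.commute)

lemma qpoch_Suc: "qpoch a (rpow l t) (int k + 1) = qpoch a (rpow l t) (int k) * (1 - a * rpow l (t * real k))"
  by (simp add: qpoch_def nat_add_distrib rpow_power)

lemma qpoch_0 [simp]: "qpoch a q 0 = 1"
  by (simp add: qpoch_def)

text \<open>The exponent is left as \<open>t * - 1\<close> so that it has the shape of the factor in
  \<open>qpoch_Suc\<close>, with -1 in place of k.\<close>

lemma qpoch_minus_1: "qpoch a (rpow l t) (- 1) = 1 / (1 - a * rpow l (t * - 1))"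
  using rpow_diff[of l 0 t] by (simp add: qpoch_def)

section \<open>Identities over fields and commutative rings\<close>

text \<open>
  Besides \<open>\<alpha>\<close>, \<open>\<beta>\<close>, \<open>\<gamma>\<close> the quadruple contains \<open>\<alpha> * \<beta> * \<gamma> / \<mu>\<^sup>2\<close>, and \<open>\<alpha> * \<beta> * \<gamma> / \<mu>\<close> is a square root
  of the product of all four; this parametrization makes the constraint on the product vanish.
\<close>

lemma quadruple_identity:
  fixes \<alpha> \<beta> \<gamma> \<mu> :: "'a::field"
  assumes "\<mu> \<noteq> 0"
  shows "(1 - \<alpha>) * (1 - \<beta>) * (1 - \<gamma>) * (1 - \<alpha> * \<beta> * \<gamma> / \<mu>\<^sup>2)
       - (1 - \<beta> * \<gamma> / \<mu>) * (1 - \<alpha> * \<gamma> / \<mu>) * (1 - \<alpha> * \<beta> / \<mu>) * (1 - \<mu>)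
       = \<mu> * ((1 - \<gamma> / \<mu>) * (1 - \<alpha> / \<mu>) * (1 - \<beta> / \<mu>) * (1 - \<alpha> * \<beta> * \<gamma> / \<mu>))"
proof -
  define \<nu> where "\<nu> = inverse \<mu>"
  have "\<mu> * \<nu> = 1"
    using assms by (simp add: \<nu>_def)
  then have "(1 - \<alpha>) * (1 - \<beta>) * (1 - \<gamma>) * (1 - \<alpha> * \<beta> * \<gamma> * \<nu>\<^sup>2)
       - (1 - \<beta> * \<gamma> * \<nu>) * (1 - \<alpha> * \<gamma> * \<nu>) * (1 - \<alpha> * \<beta> * \<nu>) * (1 - \<mu>)
       = \<mu> * ((1 - \<gamma> * \<nu>) * (1 - \<alpha> * \<nu>) * (1 - \<beta> * \<nu>) * (1 - \<alpha> * \<beta> * \<gamma> * \<nu>))"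
    by algebra
  then show ?thesis
    by (simp add: \<nu>_def divide_inverse power_inverse)
qed

lemma summation_by_parts:
  fixes U V :: "nat \<Rightarrow> 'a::comm_ring"
  shows "(\<Sum>k<n. (U (Suc k) - U k) * V k)
       = U n * V n - U 0 * V 0 - (\<Sum>k<n. U (Suc k) * (V (Suc k) - V k))"
  by (induction n) (simp_all add: algebra_simps)

section \<open>The quotient of shifted factorials in a single base\<close>

locale quadribasic =
  fixes a b c d e l :: complex and r1 r2 r3 r4 r :: real
  assumes nonzero: "a \<noteq> 0" "b \<noteq> 0" "c \<noteq> 0" "d \<noteq> 0" "e \<noteq> 0"
    and r_eq: "r = r1 + r2 + r3 + r4"
begin

text \<open>The ratio of consecutive values of \<open>num\<close>, as \<open>lo\<close> is for
  \<open>den\<close>. A real argument lets one formula cover both the natural indices and the index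
  -1.\<close>

definition up :: "real \<Rightarrow> complex" where
  "up t = (1 - b*exp l * rpow l (2*r1 * t)) * (1 - d*exp l * rpow l (2*r2 * t))
    * (1 - e*exp l * rpow l (2*r3 * t)) * (1 - b*c^2*d*e*exp l/a^2 * rpow l (2*r4 * t))"

definition lo :: "real \<Rightarrow> complex" where
  "lo t = (1 - c*d*e*exp l/a * rpow l ((r - 2*r1) * t)) * (1 - b*c*e*exp l/a * rpow l ((r - 2*r2) * t))
    * (1 - b*c*d*exp l/a * rpow l ((r - 2*r3) * t)) * (1 - a*exp l/c * rpow l ((r - 2*r4) * t))"

definition num :: "int \<Rightarrow> complex" where
  "num m = qpoch (b*exp l) (rpow l (2*r1)) m * qpoch (d*exp l) (rpow l (2*r2)) m
    * qpoch (e*exp l) (rpow l (2*r3)) m * qpoch (b*c^2*d*e*exp l/a^2) (rpow l (2*r4)) m"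

definition den :: "int \<Rightarrow> complex" where
  "den m = qpoch (c*d*e*exp l/a) (rpow l (r - 2*r1)) m * qpoch (b*c*e*exp l/a) (rpow l (r - 2*r2)) m
    * qpoch (b*c*d*exp l/a) (rpow l (r - 2*r3)) m * qpoch (a*exp l/c) (rpow l (r - 2*r4)) m"

text \<open>The part of a summand outside the shifted factorials: the sum in base p has it at t = k
  - 1, the sum in base q at t = k.\<close>

definition summand :: "real \<Rightarrow> complex" where
  "summand t = Dprod [c*e/a * rpow l ((r3 + r4 - r1 - r2) * t),
                      b*c/a * rpow l ((r1 + r4 - r2 - r3) * t),
                      c*d/a * rpow l ((r2 + r4 - r1 - r3) * t),
                      b*c*d*e/a * rpow l (r * t + 2)]
             * rpow l ((r - 2*r4) * t + 1)"

text \<open>This is \<open>quadruple_identity\<close> with the first three terms of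
  \<open>up\<close> as \<alpha>, \<beta>, \<gamma> and the last term of \<open>lo\<close> as \<mu>.
  The leading \<mu> supplies both a/c and the power of the base that closes
  \<open>summand\<close>.\<close>

lemma up_minus_lo: "up t - lo t = a / c * summand t"
proof -
  \<comment> \<open>All exponents that occur are integer combinations of the \<open>ri * t\<close>,
    so every power becomes a Laurent monomial in these four quantities.\<close>
  define E1 E2 E3 E4 where E: "E1 = rpow l (r1 * t)" "E2 = rpow l (r2 * t)"
    "E3 = rpow l (r3 * t)" "E4 = rpow l (r4 * t)"
  have nz [simp]: "E1 \<noteq> 0" "E2 \<noteq> 0" "E3 \<noteq> 0" "E4 \<noteq> 0"
    by (simp_all add: E)
  have sq: "rpow l (2*r1 * t) = E1\<^sup>2" "rpow l (2*r2 * t) = E2\<^sup>2"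
    "rpow l (2*r3 * t) = E3\<^sup>2" "rpow l (2*r4 * t) = E4\<^sup>2"
    by (simp_all add: E rpow_mult_2 mult.assoc)
  note expand = distrib_right left_diff_distrib rpow_add rpow_diff sq
  have lower: "rpow l ((r - 2*r1) * t) = E2*E3*E4/E1" "rpow l ((r - 2*r2) * t) = E1*E3*E4/E2"
    "rpow l ((r - 2*r3) * t) = E1*E2*E4/E3" "rpow l ((r - 2*r4) * t) = E1*E2*E3/E4"
    unfolding r_eq by (simp_all add: expand power2_eq_square flip: E)
  have cross: "rpow l ((r3 + r4 - r1 - r2) * t) = E3*E4/(E1*E2)"
    "rpow l ((r1 + r4 - r2 - r3) * t) = E1*E4/(E2*E3)"
    "rpow l ((r2 + r4 - r1 - r3) * t) = E2*E4/(E1*E3)"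
    "rpow l (r * t) = E1*E2*E3*E4"
    unfolding r_eq by (simp_all add: expand flip: E)
  define \<mu> where "\<mu> = a*exp l/c * (E1*E2*E3/E4)"
  have "\<mu> \<noteq> 0"
    using nonzero by (simp add: \<mu>_def)
  note quadruple_identity[OF this, of "b*exp l*E1\<^sup>2" "d*exp l*E2\<^sup>2" "e*exp l*E3\<^sup>2"]
  \<comment> \<open>In order: the fourth term of \<open>up\<close>, the first three terms of
    \<open>lo\<close>, and the four entries of \<open>Dprod\<close>.\<close>
  moreover have
    "b*exp l*E1\<^sup>2 * (d*exp l*E2\<^sup>2) * (e*exp l*E3\<^sup>2) / \<mu>\<^sup>2 = b*c^2*d*e*exp l/a^2 * E4\<^sup>2"
    "d*exp l*E2\<^sup>2 * (e*exp l*E3\<^sup>2) / \<mu> = c*d*e*exp l/a * (E2*E3*E4/E1)"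
    "b*exp l*E1\<^sup>2 * (e*exp l*E3\<^sup>2) / \<mu> = b*c*e*exp l/a * (E1*E3*E4/E2)"
    "b*exp l*E1\<^sup>2 * (d*exp l*E2\<^sup>2) / \<mu> = b*c*d*exp l/a * (E1*E2*E4/E3)"
    "e*exp l*E3\<^sup>2 / \<mu> = c*e/a * (E3*E4/(E1*E2))"
    "b*exp l*E1\<^sup>2 / \<mu> = b*c/a * (E1*E4/(E2*E3))"
    "d*exp l*E2\<^sup>2 / \<mu> = c*d/a * (E2*E4/(E1*E3))"
    "b*exp l*E1\<^sup>2 * (d*exp l*E2\<^sup>2) * (e*exp l*E3\<^sup>2) / \<mu> = b*c*d*e/a * (E1*E2*E3*E4 * exp l ^ 2)"
    using nonzero by (simp_all add: \<mu>_def field_simps power2_eq_square)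
  ultimately show ?thesis
    unfolding up_def lo_def summand_def Dprod_def sq lower cross rpow_add
    by (simp add: \<mu>_def mult_ac)
qed

section \<open>Differences of consecutive quotients, starting from the index -1\<close>

lemma num_0 [simp]: "num 0 = 1"
  and den_0 [simp]: "den 0 = 1"
  by (simp_all add: num_def den_def)

lemma num_Suc: "num (int k + 1) = num (int k) * up (real k)"
  unfolding num_def up_def qpoch_Suc by (simp only: mult_ac)

lemma den_Suc: "den (int k + 1) = den (int k) * lo (real k)"
  unfolding den_def lo_def qpoch_Suc by (simp only: mult_ac)

lemma num_minus_1: "num (- 1) = 1 / up (- 1)"
  unfolding num_def up_def qpoch_minus_1 by simp

lemma den_minus_1: "den (- 1) = 1 / lo (- 1)"
  unfolding den_def lo_def qpoch_minus_1 by simp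

text \<open>Over the common denominator \<open>den (int k + 1)\<close> the numerator is
  \<open>num (int k) * (up (real k) - lo (real k))\<close>.\<close>

lemma quotient_Suc_diff:
  assumes "den (int k + 1) \<noteq> 0"
  shows "num (int k + 1) / den (int k + 1) - num (int k) / den (int k)
       = a / c * (summand (real k) * (num (int k) / den (int k + 1)))"
proof -
  \<comment> \<open>The fraction is expanded by \<open>lo (real k)\<close>, which is nonzero as a
    factor of \<open>den (int k + 1)\<close>.\<close>
  have "num (int k) / den (int k) = num (int k) * lo (real k) / den (int k + 1)"
    using assms by (simp add: den_Suc)
  then show ?thesis
    by (simp add: num_Suc up_minus_lo flip: diff_divide_distrib right_diff_distrib)
qed

text \<open>The shift by one turns a sequence starting at -1 into one over the naturals, as
  \<open>summation_by_parts\<close> requires.\<close>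

definition prev_quotient :: "nat \<Rightarrow> complex" where
  "prev_quotient k = num (int k - 1) / den (int k - 1)"

lemma prev_quotient_Suc [simp]: "prev_quotient (Suc k) = num (int k) / den (int k)"
  by (simp add: prev_quotient_def)

text \<open>If \<open>lo (- 1) = 0\<close>, then \<open>den (- 1)\<close> has the junk value \<open>0\<close>, and both sides are \<open>0\<close>.\<close>

lemma prev_quotient_0: "prev_quotient 0 = lo (- 1) / up (- 1)"
  by (simp add: prev_quotient_def num_minus_1 den_minus_1)

lemma prev_quotient_Suc_diff:
  assumes "den (int k) \<noteq> 0" "up (- 1) \<noteq> 0"
  shows "prev_quotient (Suc k) - prev_quotient k
       = a / c * (summand (real k - 1) * (num (int k - 1) / den (int k)))"
proof (cases k)
  \<comment> \<open>Here the difference is \<open>1 - lo (- 1) / up (- 1)\<close>, which is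
    \<open>(up (- 1) - lo (- 1)) * num (- 1)\<close>; the denominator \<open>den 0\<close> is
    1.\<close>
  case 0
  then show ?thesis
    using assms up_minus_lo[of "- 1"]
    by (simp add: prev_quotient_0 num_minus_1 flip: times_divide_eq_right) (simp add: field_simps)
next
  case (Suc j)
  then show ?thesis
    using quotient_Suc_diff[of j] assms by (simp add: prev_quotient_def add.commute)
qed

text \<open>Pulling the power out of each factor leaves \<open>up (- 1)\<close>; the exponents
  \<open>2*ri\<close> add up to \<open>2*r\<close>.\<close>

lemma initial_up:
  "(rpow l (2*r1) - b*exp l) * (rpow l (2*r2) - d*exp l) * (rpow l (2*r3) - e*exp l)
    * (rpow l (2*r4) - b*c^2*d*e*exp l/a^2) = rpow l (2*r) * up (- 1)"
proof -
  have "rpow l (2*r) = rpow l (2*r1) * rpow l (2*r2) * rpow l (2*r3) * rpow l (2*r4)"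
    by (simp only: r_eq distrib_left rpow_add)
  moreover have "rpow l t - v = rpow l t * (1 - v * rpow l (t * - 1))" for t v
    using rpow_diff[of l 0 t] by (simp add: right_diff_distrib)
  ultimately show ?thesis
    unfolding up_def by (simp only: mult_ac)
qed

text \<open>The exponents \<open>r - 2*ri\<close> add up to \<open>4*r - 2*r\<close>, the same total
  as in \<open>initial_up\<close>, so the power cancels in the quotient of the two products.\<close>

lemma initial_lo:
  "(rpow l (r - 2*r1) - c*d*e*exp l/a) * (rpow l (r - 2*r2) - b*c*e*exp l/a)
    * (rpow l (r - 2*r3) - b*c*d*exp l/a) * (rpow l (r - 2*r4) - a*exp l/c) = rpow l (2*r) * lo (- 1)"
proof -
  have "rpow l (2*r) = rpow l (r - 2*r1) * rpow l (r - 2*r2) * rpow l (r - 2*r3) * rpow l (r - 2*r4)"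
    unfolding rpow_add[symmetric] by (rule arg_cong[of _ _ "rpow l"]) (simp add: r_eq)
  moreover have "rpow l t - v = rpow l t * (1 - v * rpow l (t * - 1))" for t v
    using rpow_diff[of l 0 t] by (simp add: right_diff_distrib)
  ultimately show ?thesis
    unfolding lo_def by (simp only: mult_ac)
qed

end

section \<open>Summation by parts across the two bases\<close>

theorem theorem4p1:
  fixes a b c d e x y z w u p q lp lq :: complex
    and r1 r2 r3 r4 s1 s2 s3 s4 r s :: real
    and n :: nat
  assumes nonzero: "a \<noteq> 0" "b \<noteq> 0" "c \<noteq> 0" "d \<noteq> 0" "e \<noteq> 0"
      "x \<noteq> 0" "y \<noteq> 0" "z \<noteq> 0" "w \<noteq> 0" "u \<noteq> 0" "p \<noteq> 0" "q \<noteq> 0"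
    and logs: "exp lp = p" "exp lq = q"
    and r_nonneg: "0 \<le> r1" "0 \<le> r2" "0 \<le> r3" "0 \<le> r4"
    and s_nonneg: "0 \<le> s1" "0 \<le> s2" "0 \<le> s3" "0 \<le> s4"
    and r_eq: "r = r1 + r2 + r3 + r4"
    and s_eq: "s = s1 + s2 + s3 + s4"
    and denom_p: "\<And>k::nat. k < n \<Longrightarrow>
        qpoch (c*d*e*p/a) (rpow lp (r - 2*r1)) (int k)
      * qpoch (b*c*e*p/a) (rpow lp (r - 2*r2)) (int k)
      * qpoch (b*c*d*p/a) (rpow lp (r - 2*r3)) (int k)
      * qpoch (a*p/c) (rpow lp (r - 2*r4)) (int k) \<noteq> 0"
    and denom_p_last:
       "qpoch (c*d*e*p/a) (rpow lp (r - 2*r1)) (int n - 1)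
      * qpoch (b*c*e*p/a) (rpow lp (r - 2*r2)) (int n - 1)
      * qpoch (b*c*d*p/a) (rpow lp (r - 2*r3)) (int n - 1)
      * qpoch (a*p/c) (rpow lp (r - 2*r4)) (int n - 1) \<noteq> 0"
    and denom_q: "\<And>k::nat. k \<le> n \<Longrightarrow>
        qpoch (z*w*u*q/x) (rpow lq (s - 2*s1)) (int k)
      * qpoch (y*z*u*q/x) (rpow lq (s - 2*s2)) (int k)
      * qpoch (y*z*w*q/x) (rpow lq (s - 2*s3)) (int k)
      * qpoch (x*q/z) (rpow lq (s - 2*s4)) (int k) \<noteq> 0"
    and denom_initial:
       "(rpow lp (2*r1) - b*p) * (rpow lp (2*r2) - d*p) * (rpow lp (2*r3) - e*p)
      * (rpow lp (2*r4) - b*c^2*d*e*p/a^2) \<noteq> 0"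
  shows
    "a / c * (\<Sum>k<n.
        Dprod [c*e/a * rpow lp ((r3 + r4 - r1 - r2) * (real k - 1)),
               b*c/a * rpow lp ((r1 + r4 - r2 - r3) * (real k - 1)),
               c*d/a * rpow lp ((r2 + r4 - r1 - r3) * (real k - 1)),
               b*c*d*e/a * rpow lp (r * (real k - 1) + 2)]
      * rpow lp ((r - 2*r4) * (real k - 1) + 1)
      * ((qpoch (b*p) (rpow lp (2*r1)) (int k - 1)
          * qpoch (d*p) (rpow lp (2*r2)) (int k - 1)
          * qpoch (e*p) (rpow lp (2*r3)) (int k - 1)
          * qpoch (b*c^2*d*e*p/a^2) (rpow lp (2*r4)) (int k - 1))
         / (qpoch (c*d*e*p/a) (rpow lp (r - 2*r1)) (int k)
          * qpoch (b*c*e*p/a) (rpow lp (r - 2*r2)) (int k)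
          * qpoch (b*c*d*p/a) (rpow lp (r - 2*r3)) (int k)
          * qpoch (a*p/c) (rpow lp (r - 2*r4)) (int k)))
      * ((qpoch (y*q) (rpow lq (2*s1)) (int k)
          * qpoch (w*q) (rpow lq (2*s2)) (int k)
          * qpoch (u*q) (rpow lq (2*s3)) (int k)
          * qpoch (y*z^2*w*u*q/x^2) (rpow lq (2*s4)) (int k))
         / (qpoch (z*w*u*q/x) (rpow lq (s - 2*s1)) (int k)
          * qpoch (y*z*u*q/x) (rpow lq (s - 2*s2)) (int k)
          * qpoch (y*z*w*q/x) (rpow lq (s - 2*s3)) (int k)
          * qpoch (x*q/z) (rpow lq (s - 2*s4)) (int k))))
   = ((qpoch (b*p) (rpow lp (2*r1)) (int n - 1)
        * qpoch (d*p) (rpow lp (2*r2)) (int n - 1)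
        * qpoch (e*p) (rpow lp (2*r3)) (int n - 1)
        * qpoch (b*c^2*d*e*p/a^2) (rpow lp (2*r4)) (int n - 1))
       / (qpoch (c*d*e*p/a) (rpow lp (r - 2*r1)) (int n - 1)
        * qpoch (b*c*e*p/a) (rpow lp (r - 2*r2)) (int n - 1)
        * qpoch (b*c*d*p/a) (rpow lp (r - 2*r3)) (int n - 1)
        * qpoch (a*p/c) (rpow lp (r - 2*r4)) (int n - 1)))
     * ((qpoch (y*q) (rpow lq (2*s1)) (int n)
        * qpoch (w*q) (rpow lq (2*s2)) (int n)
        * qpoch (u*q) (rpow lq (2*s3)) (int n)
        * qpoch (y*z^2*w*u*q/x^2) (rpow lq (2*s4)) (int n))
       / (qpoch (z*w*u*q/x) (rpow lq (s - 2*s1)) (int n)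
        * qpoch (y*z*u*q/x) (rpow lq (s - 2*s2)) (int n)
        * qpoch (y*z*w*q/x) (rpow lq (s - 2*s3)) (int n)
        * qpoch (x*q/z) (rpow lq (s - 2*s4)) (int n)))
     - ((rpow lp (r - 2*r1) - c*d*e*p/a) * (rpow lp (r - 2*r2) - b*c*e*p/a)
        * (rpow lp (r - 2*r3) - b*c*d*p/a) * (rpow lp (r - 2*r4) - a*p/c))
       / ((rpow lp (2*r1) - b*p) * (rpow lp (2*r2) - d*p) * (rpow lp (2*r3) - e*p)
        * (rpow lp (2*r4) - b*c^2*d*e*p/a^2))
     - x / z * (\<Sum>k<n.
        Dprod [y*z/x * rpow lq ((s1 + s4 - s2 - s3) * real k),
               z*u/x * rpow lq ((s3 + s4 - s1 - s2) * real k),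
               z*w/x * rpow lq ((s2 + s4 - s1 - s3) * real k),
               y*z*w*u/x * rpow lq (s * real k + 2)]
      * rpow lq ((s - 2*s4) * real k + 1)
      * ((qpoch (y*q) (rpow lq (2*s1)) (int k)
          * qpoch (w*q) (rpow lq (2*s2)) (int k)
          * qpoch (u*q) (rpow lq (2*s3)) (int k)
          * qpoch (y*z^2*w*u*q/x^2) (rpow lq (2*s4)) (int k))
         / (qpoch (z*w*u*q/x) (rpow lq (s - 2*s1)) (int k + 1)
          * qpoch (y*z*u*q/x) (rpow lq (s - 2*s2)) (int k + 1)
          * qpoch (y*z*w*q/x) (rpow lq (s - 2*s3)) (int k + 1)
          * qpoch (x*q/z) (rpow lq (s - 2*s4)) (int k + 1)))
      * ((qpoch (b*p) (rpow lp (2*r1)) (int k)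
          * qpoch (d*p) (rpow lp (2*r2)) (int k)
          * qpoch (e*p) (rpow lp (2*r3)) (int k)
          * qpoch (b*c^2*d*e*p/a^2) (rpow lp (2*r4)) (int k))
         / (qpoch (c*d*e*p/a) (rpow lp (r - 2*r1)) (int k)
          * qpoch (b*c*e*p/a) (rpow lp (r - 2*r2)) (int k)
          * qpoch (b*c*d*p/a) (rpow lp (r - 2*r3)) (int k)
          * qpoch (a*p/c) (rpow lp (r - 2*r4)) (int k))))"
proof -
  \<comment> \<open>The data of base q arise from those of base p by replacing a, b, c, d, e with x,
    y, z, w, u.\<close>
  interpret P: quadribasic a b c d e lp r1 r2 r3 r4 r
    by unfold_locales (use nonzero r_eq in auto)
  interpret Q: quadribasic x y z w u lq s1 s2 s3 s4 s
    by unfold_locales (use nonzero s_eq in auto)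
  note P_folds = P.num_def[unfolded logs, symmetric] P.den_def[unfolded logs, symmetric]
  note Q_folds = Q.num_def[unfolded logs, symmetric] Q.den_def[unfolded logs, symmetric]
  define V where "V k = Q.num (int k) / Q.den (int k)" for k
  have V_diff: "V (Suc k) - V k
      = x / z * (Q.summand (real k) * (Q.num (int k) / Q.den (int k + 1)))" if "k < n" for k
  proof -
    have "Q.den (int k + 1) \<noteq> 0"
      \<comment> \<open>The index k + 1 is at most n, so the range of \<open>denom_q\<close>
        includes it.\<close>
      using denom_q[of "Suc k"] that unfolding Q_folds by (simp add: add.commute)
    from Q.quotient_Suc_diff[OF this] show ?thesis
      by (simp add: V_def add.commute)
  qed
  have "P.up (- 1) \<noteq> 0"
    using denom_initial P.initial_up unfolding logs by auto
  then have U_diff: "P.prev_quotient (Suc k) - P.prev_quotient k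
      = a / c * (P.summand (real k - 1) * (P.num (int k - 1) / P.den (int k)))" if "k < n" for k
    using denom_p[OF that] unfolding P_folds by (intro P.prev_quotient_Suc_diff) auto
  \<comment> \<open>The first two entries of \<open>Dprod\<close> stand in the opposite order in the
    sum over base q.\<close>
  have Q_summand: "Dprod [y*z/x * rpow lq ((s1 + s4 - s2 - s3) * t),
               z*u/x * rpow lq ((s3 + s4 - s1 - s2) * t),
               z*w/x * rpow lq ((s2 + s4 - s1 - s3) * t),
               y*z*w*u/x * rpow lq (s * t + 2)] * rpow lq ((s - 2*s4) * t + 1) = Q.summand t" for t
    unfolding Q.summand_def Dprod_def by simp
  have "a / c * (\<Sum>k<n. P.summand (real k - 1) * (P.num (int k - 1) / P.den (int k)) * V k)
      = (\<Sum>k<n. (P.prev_quotient (Suc k) - P.prev_quotient k) * V k)"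
    unfolding sum_distrib_left by (intro sum.cong) (simp_all add: U_diff del: P.prev_quotient_Suc)
  also have "\<dots> = P.prev_quotient n * V n - P.prev_quotient 0 * V 0
      - (\<Sum>k<n. P.prev_quotient (Suc k) * (V (Suc k) - V k))"
    by (rule summation_by_parts)
  \<comment> \<open>The shift disappears: \<open>P.prev_quotient (Suc k)\<close> is the quotient at
    index k itself.\<close>
  also have "(\<Sum>k<n. P.prev_quotient (Suc k) * (V (Suc k) - V k))
      = x / z * (\<Sum>k<n. Q.summand (real k) * (Q.num (int k) / Q.den (int k + 1))
          * (P.num (int k) / P.den (int k)))"
    unfolding sum_distrib_left by (intro sum.cong) (simp_all add: V_diff mult_ac)
  \<comment> \<open>\<open>V 0\<close> is 1, and expanding by the nonzero
    \<open>rpow lp (2*r)\<close> prepares for \<open>P.initial_lo\<close> and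
    \<open>P.initial_up\<close>.\<close>
  also have "P.prev_quotient 0 * V 0 = (rpow lp (2*r) * P.lo (- 1)) / (rpow lp (2*r) * P.up (- 1))"
    by (simp add: P.prev_quotient_0 V_def)
  finally show ?thesis
    unfolding P_folds Q_folds Q_summand P.summand_def[symmetric] V_def P.prev_quotient_def
      P.initial_up[unfolded logs] P.initial_lo[unfolded logs] .
qed

end
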